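(* Let $u$ and $v$ be positive integers with $u,v>1$, and let $e$ and $f$ be rational numbers such that $eu\in\mathbb{N}$ and $fv\in\mathbb{N}$. Then $$\left[0;\overline{eu^{n},\ fv^{n}}\right]_{n=1}^{\infty}=\left(\frac{1}{eu}-\frac{1}{e^2fu^2v+e}\right)\frac{\displaystyle\sum_{n=0}^{\infty}\frac{(ef)^{-n}(uv)^{-n(n+3)/2}}{\left(\frac{1}{uv};\frac{1}{uv}\right)_n\left(-\frac{1}{efu^3v^2};\frac{1}{uv}\right)_n}}{\displaystyle\sum_{n=0}^{\infty}\frac{(ef)^{-n}(uv)^{-n(n+1)/2}}{\left(\frac{1}{uv};\frac{1}{uv}\right)_n\left(-\frac{1}{efu^2v};\frac{1}{uv}\right)_n}}.$$
   Context: $\mathbb{N}$ denotes the positive integers. $[0;x_1,x_2,x_3,\dots]$ denotes the value (limit of convergents) of the continued fraction $\cfrac{1}{x_1+\cfrac{1}{x_2+\cfrac{1}{x_3+\cdots}}}$. The notation $[0;\overline{f_1(n),\dots,f_k(n)}]_{n=1}^\infty$ means that the partial quotients are the blocks $f_1(n),\dots,f_k(n)$ concatenated for $n=1,2,3,\dots$. Finally $(z;q)_0=1$ and $(z;q)_n=\prod_{k=0}^{n-1}(1-zq^k)$ for $n\ge1$.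
   Formalization: The printed identity fails for all admissible e, f, u, v (e.g. e=f=1, u=v=2: left side ≈0.4086, right side ≈0.3198); the quotient of the two series multiplies only 1/(e²fu²v+e), not the whole bracket: 1/(eu) − (1/(e²fu²v+e))·(quotient). *)

theory Defs
  imports Complex_Main
begin

(* The quotient list [x1, ..., xk] stands for the finite continued fraction [0; x1, ..., xk]. *)
fun fin_cfrac :: "real list \<Rightarrow> real" where
  "fin_cfrac [] = 0"
| "fin_cfrac (x # xs) = 1 / (x + fin_cfrac xs)"

(* Partial quotients are indexed from 0: x 0 is the first one after the semicolon. *)
definition cfrac_convergent :: "(nat \<Rightarrow> real) \<Rightarrow> nat \<Rightarrow> real" where
  "cfrac_convergent x n = fin_cfrac (map x [0..<n])"

(* Only meaningful if the sequence of convergents converges. *)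
definition cfrac_value :: "(nat \<Rightarrow> real) \<Rightarrow> real" where
  "cfrac_value x = lim (cfrac_convergent x)"

(* The sequence f1(1), ..., fk(1), f1(2), ..., fk(2), ..., where fs = [f1, ..., fk]:
   positions count from 0, the block number n from 1. *)
definition block_quotients :: "(nat \<Rightarrow> real) list \<Rightarrow> nat \<Rightarrow> real" where
  "block_quotients fs i = (fs ! (i mod length fs)) (i div length fs + 1)"

definition qpoch :: "real \<Rightarrow> real \<Rightarrow> nat \<Rightarrow> real" where
  "qpoch z q n = (\<Prod>k<n. 1 - z * q ^ k)"

(* Pitfall: in the closed form for [0; e u, f v, e u^2, f v^2, ...] the quotient of the two
   series multiplies only 1 / (e^2 f u^2 v + e).  The variant
   (1 / (e u) - 1 / (e^2 f u^2 v + e)) * (quotient) holds for no admissible e, f, u, v: the series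
   in the numerator is termwise at most the one in the denominator, so that variant is at most
   1 / (e u) - 1 / (e^2 f u^2 v + e), which is smaller than the second convergent
   1 / (e u) - 1 / (e^2 f u^2 v + e u), a lower bound of the continued fraction. *)

end

theory Submission
  imports Defs
begin

text \<open>
  Put \<open>H(x, z) = \<Sum>n. x^n q^(n(n-1)/2) / ((q;q)_n (-z;q)_n)\<close>. Comparing coefficients of \<open>x^n\<close> gives
  \<open>(1 + z) H(x, z) = (1 + x + z) H(xq, zq) - z x q / (1 + zq) H(xq\<^sup>2, zq\<^sup>2)\<close>.
  For \<open>x = q^k / (efuv)\<close>, \<open>z = x / u\<close> and \<open>r\<^sub>k = x / (1 + z) * H(xq, zq) / H(x, z)\<close> this says that
  \<open>w\<^sub>k = (1 - r\<^sub>k) / (e u^(k+1))\<close> satisfies \<open>w\<^sub>k = 1 / (e u^(k+1) + 1 / (f v^(k+1) + w\<^sub>k\<^sub>+\<^sub>1))\<close>.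
  Termwise comparison gives \<open>r\<^sub>k \<le> x \<le> 1\<close>, so the \<open>w\<^sub>k\<close> are nonnegative; since the partial quotients are
  at least 1, nonnegative tails satisfying this recursion are the limits of the convergents.
\<close>

section \<open>Continued fractions with partial quotients at least 1\<close>

lemma fin_cfrac_bounds:
  assumes "\<And>y. y \<in> set xs \<Longrightarrow> y \<ge> 1"
  shows "0 \<le> fin_cfrac xs \<and> fin_cfrac xs \<le> 1"
  using assms
proof (induction xs)
  case (Cons y xs)
  then have "0 \<le> fin_cfrac xs" "y \<ge> 1" by auto
  then show ?case by (simp add: field_simps)
qed simp

text \<open>Going one level up multiplies the distance to the tail by at most \<open>w m\<close>.
  This factor alone may be close to 1, but two consecutive factors multiply to at most 1/2, so two
  levels halve the error; hence the exponent \<open>n div 2\<close>.\<close>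

lemma fin_cfrac_tail_error:
  fixes x w :: "nat \<Rightarrow> real"
  assumes x: "\<And>i. x i \<ge> 1" and w: "\<And>i. w i \<ge> 0"
    and rec: "\<And>i. w i = 1 / (x i + w (Suc i))"
  shows "\<bar>fin_cfrac (map x [m..<m + n]) - w m\<bar> \<le> (1 / 2) ^ (n div 2)"
proof -
  have w1: "w i \<le> 1" for i
    using x[of i] w[of "Suc i"] by (subst rec) (simp add: field_simps)
  \<comment> \<open>The product is \<open>w (Suc i) / (x i + w (Suc i))\<close>, and
    \<open>w (Suc i)\<close> \<le> 1 \<le> \<open>x i\<close>.\<close>
  have w2: "w i * w (Suc i) \<le> 1 / 2" for i
    using x[of i] w[of "Suc i"] w1[of "Suc i"] by (subst rec[of i]) (simp add: field_simps)
  have fin: "0 \<le> fin_cfrac (map x [i..<j])" "fin_cfrac (map x [i..<j]) \<le> 1" for i j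
    using fin_cfrac_bounds[of "map x [i..<j]"] x by auto
  have step: "\<bar>fin_cfrac (map x [m..<m + Suc n]) - w m\<bar>
      \<le> w m * \<bar>fin_cfrac (map x [Suc m..<Suc m + n]) - w (Suc m)\<bar>" for m n
  proof -
    define t where "t = fin_cfrac (map x [Suc m..<Suc m + n])"
    have fm: "fin_cfrac (map x [m..<m + Suc n]) = 1 / (x m + t)"
      by (simp add: t_def upt_conv_Cons del: upt_Suc)
    have pos: "x m + t > 0" "x m + w (Suc m) > 0"
      using x[of m] w[of "Suc m"] fin[of "Suc m" "Suc m + n"] by (auto simp: t_def)
    have "1 / (x m + t) - w m = w m * (1 / (x m + t)) * (w (Suc m) - t)"
      using pos by (subst (1 2) rec[of m]) (simp add: field_simps)
    then have "\<bar>1 / (x m + t) - w m\<bar> = w m * (1 / (x m + t)) * \<bar>t - w (Suc m)\<bar>"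
      using w[of m] pos by (simp add: abs_mult abs_minus_commute)
    \<comment> \<open>The factor \<open>1 / (x m + t)\<close> is itself a finite continued fraction,
      hence at most 1.\<close>
    also have "\<dots> \<le> w m * 1 * \<bar>t - w (Suc m)\<bar>"
      using w[of m] fin(2)[of m "m + Suc n"] unfolding fm
      by (intro mult_right_mono mult_left_mono) auto
    finally show ?thesis unfolding fm t_def mult_1_right .
  qed
  show ?thesis
  proof (induction n arbitrary: m rule: nat_less_induct)
    case (1 n)
    show ?case
    proof (cases "n < 2")
      case True
      then have "n div 2 = 0" by simp
      moreover have "\<bar>fin_cfrac (map x [m..<m + n]) - w m\<bar> \<le> 1"
        using fin[of m "m + n"] w[of m] w1[of m] by (auto simp: abs_if)
      ultimately show ?thesis by simp
    next
      case False
      then obtain k where n: "n = Suc (Suc k)" using less_iff_Suc_add[of 1 n] by auto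
      let ?E = "\<bar>fin_cfrac (map x [Suc (Suc m)..<Suc (Suc m) + k]) - w (Suc (Suc m))\<bar>"
      have "\<bar>fin_cfrac (map x [m..<m + n]) - w m\<bar> \<le> w m * (w (Suc m) * ?E)"
        unfolding n by (rule order_trans[OF step mult_left_mono[OF step w]])
      also have "\<dots> = w m * w (Suc m) * ?E" by (rule mult.assoc[symmetric])
      also have "\<dots> \<le> 1 / 2 * (1 / 2) ^ (k div 2)"
      proof (intro mult_mono w2)
        show "?E \<le> (1 / 2) ^ (k div 2)"
          by (rule 1[rule_format]) (simp add: n)
      qed simp_all
      finally show ?thesis by (simp add: n)
    qed
  qed
qed

text \<open>The error bound from index 0 on yields existence and value of the limit at once.\<close>

lemma cfrac_convergent_tendsto:
  fixes x w :: "nat \<Rightarrow> real"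
  assumes "\<And>i. x i \<ge> 1" and "\<And>i. w i \<ge> 0" and "\<And>i. w i = 1 / (x i + w (Suc i))"
  shows "cfrac_convergent x \<longlonglongrightarrow> w 0"
proof (rule LIM_zero_cancel, rule tendsto_0_le)
  show "\<forall>\<^sub>F n in sequentially.
      norm (cfrac_convergent x n - w 0) \<le> norm ((1 / 2 :: real) ^ (n div 2)) * 1"
    using fin_cfrac_tail_error[of x w 0, OF assms] by (simp add: cfrac_convergent_def)
  have "filterlim (\<lambda>n::nat. n div 2) at_top sequentially"
    by (rule filterlim_at_top_div_const_nat) simp
  then show "(\<lambda>n. (1 / 2 :: real) ^ (n div 2)) \<longlonglongrightarrow> 0"
    by (rule filterlim_compose[rotated]) (simp add: LIMSEQ_realpow_zero)
qed

section \<open>q-Pochhammer symbols and the terms of the series \<open>H\<close>\<close>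

lemma qpoch_0 [simp]: "qpoch z q 0 = 1"
  by (simp add: qpoch_def)

lemma qpoch_Suc: "qpoch z q (Suc n) = qpoch z q n * (1 - z * q ^ n)"
  by (simp add: qpoch_def)

text \<open>Splitting off the first factor; compared with splitting off the last one, this relates
  the symbols at \<open>z\<close> and \<open>z * q\<close>.\<close>

lemma qpoch_Suc_shift: "qpoch z q (Suc n) = (1 - z) * qpoch (z * q) q n"
  unfolding qpoch_def prod.lessThan_Suc_shift by (simp add: mult_ac)

lemma qpoch_q_pos:
  assumes "0 < q" "q < 1"
  shows "qpoch q q n > 0"
  unfolding qpoch_def
proof (rule prod_pos)
  fix k
  show "0 < 1 - q * q ^ k"
    using power_Suc_less_one[of q k] assms by simp
qed

lemma qpoch_minus_pos:
  assumes "0 \<le> q" "0 \<le> z"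
  shows "qpoch (- z) q n > 0"
  unfolding qpoch_def using assms by (intro prod_pos) (simp add: add_pos_nonneg)

text \<open>The terms of \<open>H(x, z)\<close>, which is the basic hypergeometric series 1phi1(0;
  -z; q, -x): the signs of 1phi1 cancel against those of the argument.\<close>

definition qhyp_term :: "real \<Rightarrow> real \<Rightarrow> real \<Rightarrow> nat \<Rightarrow> real" where
  "qhyp_term q x z n = x ^ n * q ^ (n * (n - 1) div 2) / (qpoch q q n * qpoch (- z) q n)"

definition qhyp :: "real \<Rightarrow> real \<Rightarrow> real \<Rightarrow> real" where
  "qhyp q x z = (\<Sum>n. qhyp_term q x z n)"

lemma triangle_Suc: "Suc n * (Suc n - 1) div 2 = n * (n - 1) div 2 + n"
  by (cases n) simp_all

lemma qhyp_term_0 [simp]: "qhyp_term q x z 0 = 1"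
  by (simp add: qhyp_term_def)

lemma qhyp_term_Suc:
  "qhyp_term q x z (Suc n) = qhyp_term q x z n * (x * q ^ n / ((1 - q ^ Suc n) * (1 + z * q ^ n)))"
  unfolding qhyp_term_def triangle_Suc qpoch_Suc power_add by (simp add: mult_ac)

section \<open>Convergence and contiguous relation of the series for 0 < q < 1\<close>

context
  fixes q :: real
  assumes q: "0 < q" "q < 1"
begin

lemma qhyp_term_pos:
  assumes "x > 0" "z \<ge> 0"
  shows "qhyp_term q x z n > 0"
  unfolding qhyp_term_def using assms q qpoch_q_pos[OF q] qpoch_minus_pos[of q z n]
  by (intro divide_pos_pos mult_pos_pos) auto

text \<open>The denominator of the term ratio is at least \<open>1 - q\<close>, so the ratio is at
  most \<open>x * q ^ n / (1 - q)\<close>, which tends to 0.\<close>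

lemma summable_qhyp_term:
  assumes "x > 0" "z \<ge> 0"
  shows "summable (qhyp_term q x z)"
proof -
  have "(\<lambda>n. x * q ^ n / (1 - q)) \<longlonglongrightarrow> x * 0 / (1 - q)"
    by (intro tendsto_intros LIMSEQ_realpow_zero) (use q in auto)
  then have "\<forall>\<^sub>F n in sequentially. x * q ^ n / (1 - q) < 1 / 2"
    by (rule order_tendstoD(2)) simp
  then obtain N where N: "x * q ^ n / (1 - q) < 1 / 2" if "n \<ge> N" for n
    by (auto simp: eventually_sequentially)
  show ?thesis
  proof (rule summable_ratio_test[of "1 / 2" N])
    fix n assume n: "N \<le> n"
    have "q ^ Suc n \<le> q"
      using q power_le_one[of q n] by (simp add: mult_left_le)
    then have "(1 - q) * 1 \<le> (1 - q ^ Suc n) * (1 + z * q ^ n)"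
      using q assms power_Suc_less_one[of q n] by (intro mult_mono) auto
    then have "x * q ^ n / ((1 - q ^ Suc n) * (1 + z * q ^ n)) \<le> x * q ^ n / (1 - q)"
      using q assms by (intro divide_left_mono) auto
    also have "\<dots> \<le> 1 / 2" using N[OF n] by simp
    finally have "qhyp_term q x z (Suc n) \<le> qhyp_term q x z n * (1 / 2)"
      unfolding qhyp_term_Suc using qhyp_term_pos[OF assms, of n] by (intro mult_left_mono) auto
    then show "norm (qhyp_term q x z (Suc n)) \<le> 1 / 2 * norm (qhyp_term q x z n)"
      using qhyp_term_pos[OF assms, of n] qhyp_term_pos[OF assms, of "Suc n"] by simp
  qed simp
qed

lemma qhyp_pos: "x > 0 \<Longrightarrow> z \<ge> 0 \<Longrightarrow> qhyp q x z > 0"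
  unfolding qhyp_def by (intro suminf_pos summable_qhyp_term qhyp_term_pos)

text \<open>Holds termwise: \<open>(x * q) ^ n\<close> \<le> \<open>x ^ n\<close>, and
  \<open>(1 + z) (-zq;q)_n\<close> exceeds \<open>(-z;q)_n\<close> by the factor
  \<open>1 + z * q ^ n\<close>. It is what bounds \<open>r\<^sub>k\<close> by
  \<open>x\<close>.\<close>

lemma qhyp_shift_le:
  assumes "x > 0" "z \<ge> 0"
  shows "qhyp q (x * q) (z * q) \<le> (1 + z) * qhyp q x z"
proof -
  have "qhyp_term q (x * q) (z * q) n \<le> (1 + z) * qhyp_term q x z n" for n
  proof -
    have eq: "(1 + z) * qpoch (- (z * q)) q n = qpoch (- z) q n * (1 + z * q ^ n)"
      using qpoch_Suc_shift[of "- z" q n] qpoch_Suc[of "- z" q n] by simp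
    have pos: "qpoch (- (z * q)) q n > 0" "qpoch (- z) q n > 0" "qpoch q q n > 0"
      using qpoch_minus_pos[of q] qpoch_q_pos[OF q] q assms by auto
    have le: "qpoch (- z) q n \<le> (1 + z) * qpoch (- (z * q)) q n"
      unfolding eq using pos assms q by (simp add: mult_le_cancel_left1)
    have "(x * q) ^ n \<le> x ^ n"
      using assms q by (intro power_mono) (auto simp: mult_left_le)
    then have "qhyp_term q (x * q) (z * q) n
        \<le> x ^ n * q ^ (n * (n - 1) div 2) / (qpoch q q n * qpoch (- (z * q)) q n)"
      unfolding qhyp_term_def using pos q by (intro divide_right_mono mult_right_mono) auto
    also have "\<dots> = (1 + z) * (x ^ n * q ^ (n * (n - 1) div 2))
        / (qpoch q q n * ((1 + z) * qpoch (- (z * q)) q n))"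
      using assms by (subst mult.left_commute) simp
    also have "\<dots> \<le> (1 + z) * (x ^ n * q ^ (n * (n - 1) div 2)) / (qpoch q q n * qpoch (- z) q n)"
      using pos assms q le by (intro divide_left_mono mult_left_mono) auto
    finally show ?thesis by (simp add: qhyp_term_def)
  qed
  then have "qhyp q (x * q) (z * q) \<le> (\<Sum>n. (1 + z) * qhyp_term q x z n)"
    unfolding qhyp_def using assms q
    by (intro suminf_le summable_mult summable_qhyp_term) auto
  then show ?thesis
    using suminf_mult[OF summable_qhyp_term[OF assms]] by (simp add: qhyp_def)
qed

text \<open>This compares the parts of degree n + 1 in \<open>x\<close>. A series that is multiplied
  by \<open>x\<close> contributes its term of index \<open>n\<close>, the others their term of index
  \<open>Suc n\<close>.\<close>

lemma qhyp_term_contiguous: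
  assumes "x > 0" "z \<ge> 0"
  shows "(1 + z) * qhyp_term q x z (Suc n) =
    (1 + z) * qhyp_term q (x * q) (z * q) (Suc n) + x * qhyp_term q (x * q) (z * q) n
      - z * x * q / (1 + z * q) * qhyp_term q (x * q * q) (z * q * q) n"
proof -
  define P where "P = qpoch q q n"
  define Q where "Q = qpoch (- (z * q)) q n"
  define Q2 where "Q2 = qpoch (- (z * q * q)) q n"
  define T where "T = n * (n - 1) div 2"
  define s where "s = q ^ n"
  have pos: "P > 0" "Q > 0" "Q2 > 0" "s > 0" "1 + z > 0" "1 + z * q > 0" "1 + z * q * s > 0"
    using qpoch_minus_pos[of q] qpoch_q_pos[OF q] q assms
    by (auto simp: P_def Q_def Q2_def s_def add_pos_nonneg)
  have s1: "1 - q * s > 0" using power_Suc_less_one[of q n] q by (simp add: s_def)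
  \<comment> \<open>Both sides are \<open>(-zq;q)_(n+1)\<close>, with the first or the last factor
    split off.\<close>
  have Q2: "(1 + z * q) * Q2 = Q * (1 + z * q * s)"
    using qpoch_Suc_shift[of "- (z * q)" q n] qpoch_Suc[of "- (z * q)" q n]
    by (simp add: Q_def Q2_def s_def)
  define A where "A = x ^ n * q ^ T / (P * Q)"
  have h0: "(1 + z) * qhyp_term q x z (Suc n) = A * (x * s / (1 - q * s))"
  proof -
    have "qhyp_term q x z (Suc n) = x * x ^ n * (q ^ T * s) / (P * (1 - q * s) * ((1 + z) * Q))"
      unfolding qhyp_term_def triangle_Suc qpoch_Suc[of q q] qpoch_Suc_shift[of "- z"] power_add
      by (simp add: P_def Q_def T_def s_def)
    then show ?thesis
      using pos s1 by (simp add: A_def mult_ac)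
  qed
  have h1: "qhyp_term q (x * q) (z * q) n = A * s"
    by (simp add: qhyp_term_def A_def P_def Q_def T_def s_def power_mult_distrib)
  have h1': "qhyp_term q (x * q) (z * q) (Suc n)
      = A * s * (x * q * s / ((1 - q * s) * (1 + z * q * s)))"
    unfolding qhyp_term_Suc h1 by (simp add: s_def)
  have "qhyp_term q (x * q * q) (z * q * q) n / (1 + z * q)
      = x ^ n * q ^ T * s * s / (P * ((1 + z * q) * Q2))"
    by (simp add: qhyp_term_def P_def Q2_def T_def s_def power_mult_distrib mult_ac)
  also have "\<dots> = A * s * s / (1 + z * q * s)"
    unfolding Q2 by (simp add: A_def)
  finally have h2: "z * x * q / (1 + z * q) * qhyp_term q (x * q * q) (z * q * q) n
      = z * x * q * (A * s * s / (1 + z * q * s))"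
    by (metis times_divide_eq_left times_divide_eq_right)
  \<comment> \<open>With the common factor \<open>A\<close> removed, a rational identity in
    \<open>x\<close>, \<open>z\<close>, \<open>q\<close> and \<open>s\<close> remains.\<close>
  have id: "x * s / (1 - q * s) = (1 + z) * (s * (x * q * s / ((1 - q * s) * (1 + z * q * s)))) + x * s
      - z * x * q * (s * s / (1 + z * q * s))"
    using pos s1 by (simp add: divide_simps) algebra
  show ?thesis
    unfolding h0 h1 h1' h2 id by (simp only: right_diff_distrib[of A] distrib_left[of A] mult_ac times_divide_eq_right)
qed

text \<open>Summing the termwise identity gives all but the constant terms, which are
  \<open>1 + z\<close> on both sides.\<close>

lemma qhyp_contiguous:
  assumes "x > 0" "z \<ge> 0"
  shows "(1 + z) * qhyp q x z = (1 + x + z) * qhyp q (x * q) (z * q)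
    - z * x * q / (1 + z * q) * qhyp q (x * q * q) (z * q * q)"
proof -
  have sums: "qhyp_term q y t sums qhyp q y t" if "y > 0" "t \<ge> 0" for y t
    unfolding qhyp_def by (rule summable_sums[OF summable_qhyp_term[OF that]])
  have sums_tail: "(\<lambda>n. qhyp_term q y t (Suc n)) sums (qhyp q y t - 1)" if "y > 0" "t \<ge> 0" for y t
    using sums[OF that] by (simp add: sums_Suc_iff)
  have pos: "x * q > 0" "z * q \<ge> 0" "x * q * q > 0" "z * q * q \<ge> 0"
    using assms q by auto
  have "(\<lambda>n. (1 + z) * qhyp_term q x z (Suc n)) sums ((1 + z) * (qhyp q (x * q) (z * q) - 1)
      + x * qhyp q (x * q) (z * q) - z * x * q / (1 + z * q) * qhyp q (x * q * q) (z * q * q))"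
    unfolding qhyp_term_contiguous[OF assms]
    by (intro sums_add sums_diff sums_mult sums sums_tail pos)
  moreover have "(\<lambda>n. (1 + z) * qhyp_term q x z (Suc n)) sums ((1 + z) * (qhyp q x z - 1))"
    by (intro sums_mult sums_tail assms)
  ultimately have "(1 + z) * (qhyp q x z - 1) = (1 + z) * (qhyp q (x * q) (z * q) - 1)
      + x * qhyp q (x * q) (z * q) - z * x * q / (1 + z * q) * qhyp q (x * q * q) (z * q * q)"
    by (rule sums_unique2[symmetric])
  then show ?thesis by (simp add: algebra_simps)
qed

text \<open>The \<open>r\<^sub>k\<close> of the overview. The factor \<open>x / (1 + z)\<close>
  turns the three-term relation for \<open>H\<close> into a first-order recursion.\<close>

definition qratio :: "real \<Rightarrow> real \<Rightarrow> real" where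
  "qratio x z = x / (1 + z) * (qhyp q (x * q) (z * q) / qhyp q x z)"

lemma qratio_le:
  assumes "x > 0" "z \<ge> 0"
  shows "qratio x z \<le> x"
proof -
  have "qhyp q (x * q) (z * q) / ((1 + z) * qhyp q x z) \<le> 1"
    using qhyp_shift_le[OF assms] qhyp_pos[OF assms] assms by simp
  from mult_left_mono[OF this, of x] show ?thesis
    using assms by (simp add: qratio_def)
qed

text \<open>Dividing the contiguous relation by \<open>H(xq, zq)\<close> turns its last term into
  \<open>z\<close> times the next ratio.\<close>

lemma qratio_rec:
  assumes "x > 0" "z \<ge> 0"
  shows "qratio x z * (1 + x + z - z * qratio (x * q) (z * q)) = x"
proof -
  define A B C where "A = qhyp q x z" and "B = qhyp q (x * q) (z * q)"
    and "C = qhyp q (x * q * q) (z * q * q)"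
  have pos: "A > 0" "B > 0" "1 + z > 0"
    using qhyp_pos assms q by (auto simp: A_def B_def)
  have "B * (1 + x + z - z * qratio (x * q) (z * q)) = (1 + z) * A"
  proof -
    have "qratio (x * q) (z * q) = x * q / (1 + z * q) * (C / B)"
      by (simp only: qratio_def B_def C_def)
    then show ?thesis
      using pos qhyp_contiguous[OF assms, folded A_def B_def C_def]
      by (simp add: right_diff_distrib)
  qed
  moreover have "qratio x z * (1 + x + z - z * qratio (x * q) (z * q))
      = x / ((1 + z) * A) * (B * (1 + x + z - z * qratio (x * q) (z * q)))"
    by (simp add: qratio_def A_def B_def)
  ultimately show ?thesis using pos by simp
qed

end

section \<open>Specialisation to the partial quotients \<open>e u^n\<close>,
  \<open>f v^n\<close>\<close>

lemma Nats_ge_1: "r \<in> \<nat> - {0} \<Longrightarrow> (1::real) \<le> r"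
  by (auto simp: Nats_def Suc_le_eq)

theorem theorem4:
  fixes u v :: nat and e f :: real
  assumes "u > 1" and "v > 1"
    and "e \<in> \<rat>" and "f \<in> \<rat>"
    and "e * real u \<in> \<nat> - {0}" and "f * real v \<in> \<nat> - {0}"
  defines "x \<equiv> block_quotients [\<lambda>n. e * real u ^ n, \<lambda>n. f * real v ^ n]"
    and "q \<equiv> 1 / (real u * real v)"
  defines "num \<equiv> \<lambda>n::nat.
      (e * f) powi (- int n) * (real u * real v) powi (- int (n * (n + 3) div 2))
        / (qpoch q q n * qpoch (- 1 / (e * f * real u ^ 3 * real v ^ 2)) q n)"
    and "den \<equiv> \<lambda>n::nat.
      (e * f) powi (- int n) * (real u * real v) powi (- int (n * (n + 1) div 2))
        / (qpoch q q n * qpoch (- 1 / (e * f * real u ^ 2 * real v)) q n)"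
  shows "convergent (cfrac_convergent x) \<and> summable num \<and> summable den \<and>
    cfrac_value x =
      1 / (e * real u)
        - 1 / (e ^ 2 * f * real u ^ 2 * real v + e) * ((\<Sum>n. num n) / (\<Sum>n. den n))"
proof -
  define a b where "a \<equiv> \<lambda>k. e * real u ^ Suc k" and "b \<equiv> \<lambda>k. f * real v ^ Suc k"
  \<comment> \<open>Here \<open>X k\<close> equals \<open>q^k / (efuv)\<close>. Both sequences are
    geometric with ratio \<open>q\<close>, so \<open>r k\<close> and \<open>r (Suc k)\<close> are
    linked by \<open>qratio_rec\<close>.\<close>
  define X Z where "X \<equiv> \<lambda>k. 1 / (a k * b k)" and "Z \<equiv> \<lambda>k. X k / real u"
  define r where "r \<equiv> \<lambda>k. qratio q (X k) (Z k)"
  define t where "t \<equiv> \<lambda>k. (1 - r k) / a k"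
  \<comment> \<open>\<open>t k\<close> is the tail that starts at \<open>a k\<close>; the odd
    indices hold the tails that start at \<open>b k\<close>.\<close>
  define w where "w \<equiv> \<lambda>i. if even i then t (i div 2) else 1 / (b (i div 2) + t (Suc (i div 2)))"
  have u: "real u > 1" and v: "real v > 1" using assms(1,2) by auto
  have eu: "e * real u \<ge> 1" and fv: "f * real v \<ge> 1"
    using Nats_ge_1[OF assms(5)] Nats_ge_1[OF assms(6)] .
  have e: "e > 0" and f: "f > 0"
    using zero_less_mult_pos2[of e "real u"] zero_less_mult_pos2[of f "real v"] eu fv u v by auto
  have uv: "real u * real v > 1" using u v by (simp add: less_1_mult)
  have q: "0 < q" "q < 1" using uv by (auto simp: q_def)
  \<comment> \<open>Since \<open>e\<close> may be less than 1, the power is split as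
    \<open>(e * u) * u ^ k\<close>, with both factors at least 1.\<close>
  have a: "a k \<ge> 1" for k
    using mult_mono[OF eu one_le_power[of "real u" k]] u e by (simp add: a_def mult_ac)
  have b: "b k \<ge> 1" for k
    using mult_mono[OF fv one_le_power[of "real v" k]] v f by (simp add: b_def mult_ac)
  have a0: "a k > 0" and b0: "b k > 0" for k
    using a[of k] b[of k] by auto
  have X: "X k > 0" and Z: "Z k \<ge> 0" for k
    using a0[of k] b0[of k] u by (auto simp: X_def Z_def)
  have X1: "X k \<le> 1" for k
    using mult_mono[OF a[of k] b[of k]] a0[of k] b0[of k] by (simp add: X_def)
  have XS: "X (Suc k) = X k * q" and ZS: "Z (Suc k) = Z k * q" for k
    by (simp_all add: Z_def X_def a_def b_def q_def)
  have t0: "t k \<ge> 0" for k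
    using qratio_le[OF q X[of k] Z[of k]] X1[of k] a0[of k] by (simp add: t_def r_def)
  have t_rec: "t k = 1 / (a k + 1 / (b k + t (Suc k)))" for k
  proof -
    have rr: "r k * (1 + X k + Z k - Z k * r (Suc k)) = X k"
      using qratio_rec[OF q X Z, of k k] by (simp add: r_def XS ZS)
    have Xab: "X k * (a k * b k) = 1" using a0[of k] b0[of k] by (simp add: X_def)
    have at: "a k * t k = 1 - r k" using a0[of k] by (simp add: t_def)
    have "a (Suc k) = a k * real u" by (simp add: a_def)
    then have Zt: "Z k * (1 - r (Suc k)) = X k * a k * t (Suc k)"
      using a0[of k] u by (simp add: t_def Z_def)
    \<comment> \<open>The recursion with denominators cleared, multiplied by
      \<open>X k * a k\<close>: then \<open>Xab\<close> and \<open>Zt\<close> express everything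
      through \<open>r\<close>, \<open>X\<close> and \<open>Z\<close>, and \<open>rr\<close>
      applies.\<close>
    have "X k * a k * (t k * (a k * b k + a k * t (Suc k) + 1))
        = (a k * t k) * (X k * (a k * b k) + X k * a k * t (Suc k) + X k)"
      by (simp add: algebra_simps)
    also have "\<dots> = (1 - r k) * (1 + Z k * (1 - r (Suc k)) + X k)"
      unfolding at Xab Zt ..
    also have "\<dots> = 1 + Z k * (1 - r (Suc k))"
      using rr by (simp add: algebra_simps)
    also have "\<dots> = X k * a k * (b k + t (Suc k))"
      unfolding Zt by (subst Xab[symmetric]) (simp add: algebra_simps)
    finally have "X k * a k * (t k * (a k * b k + a k * t (Suc k) + 1)) = X k * a k * (b k + t (Suc k))" .
    then have "t k * (a k * b k + a k * t (Suc k) + 1) = b k + t (Suc k)"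
      using X[of k] a0[of k] by simp
    moreover have "b k + t (Suc k) > 0" "a k * b k + a k * t (Suc k) + 1 > 0"
      using a0[of k] b0[of k] t0[of "Suc k"] by (auto intro!: add_pos_nonneg add_nonneg_pos)
    ultimately show ?thesis by (simp add: field_simps)
  qed
  have x_eq: "x i = (if even i then a (i div 2) else b (i div 2))" for i
    by (cases "even i")
      (simp_all add: x_def block_quotients_def a_def b_def mod_2_eq_odd numeral_2_eq_2[symmetric])
  have lim: "cfrac_convergent x \<longlonglongrightarrow> w 0"
  proof (rule cfrac_convergent_tendsto)
    fix i
    show "x i \<ge> 1" using a b by (simp add: x_eq)
    show "w i \<ge> 0" using t0 b0[of "i div 2"] by (simp add: w_def add_nonneg_nonneg less_imp_le)
    show "w i = 1 / (x i + w (Suc i))"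
      using t_rec[of "i div 2"] by (auto simp: w_def x_eq elim!: evenE oddE)
  qed
  have pow: "(e * f) powi (- int n) * (real u * real v) powi (- int m)
      = (1 / (e * f)) ^ n * q ^ m" for n m
    by (simp add: q_def power_int_minus divide_inverse power_inverse[symmetric] power_mult_distrib)
  \<comment> \<open>Splitting off the exponent \<open>n * (n - 1) div 2\<close> of \<open>H\<close>
    leaves \<open>q^n\<close> and \<open>q^(2n)\<close>, which the n-th powers of
    \<open>X 0 = q / (ef)\<close> and \<open>X 1 = q^2 / (ef)\<close> absorb.\<close>
  have tri1: "n * (n + 1) div 2 = n + n * (n - 1) div 2" for n :: nat
    using triangle_Suc[of n] by (simp add: mult.commute)
  have tri3: "n * (n + 3) div 2 = 2 * n + n * (n - 1) div 2" for n :: nat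
  proof -
    have "n * (n + 3) = 2 * (2 * n) + n * (n - 1)"
      by (cases n) (simp_all add: algebra_simps)
    then show ?thesis by simp
  qed
  have X0: "X 0 = 1 / (e * f) * q" and Z0: "Z 0 = 1 / (e * f * real u ^ 2 * real v)"
    and Z1: "Z 1 = 1 / (e * f * real u ^ 3 * real v ^ 2)"
    using u v by (simp_all add: X_def Z_def a_def b_def q_def power2_eq_square power3_eq_cube field_simps)
  have X1q: "X 1 = 1 / (e * f) * q\<^sup>2"
    using XS[of 0] by (simp add: X0 power2_eq_square)
  have den: "den = qhyp_term q (X 0) (Z 0)"
    by (rule ext) (simp only: den_def qhyp_term_def pow tri1 X0 Z0 power_mult_distrib power_add
      minus_divide_left mult.assoc)
  have num: "num = qhyp_term q (X 1) (Z 1)"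
    by (rule ext) (simp only: num_def qhyp_term_def pow tri3 X1q Z1 power_mult_distrib power_add
      minus_divide_left mult.assoc power_mult)
  \<comment> \<open>Only \<open>r 0\<close> contains the quotient of the two series, so its
    prefactor multiplies the second summand alone.\<close>
  have "w 0 = 1 / (e * real u) - r 0 / (e * real u)"
    by (simp add: w_def t_def a_def diff_divide_distrib)
  also have "r 0 / (e * real u) = X 0 / (1 + Z 0) / (e * real u) * (suminf num / suminf den)"
    using XS[of 0] ZS[of 0] by (simp add: r_def qratio_def[OF q] qhyp_def num den)
  also have "X 0 / (1 + Z 0) / (e * real u) = 1 / (e ^ 2 * f * real u ^ 2 * real v + e)"
  proof -
    have "1 + Z 0 = (e * f * real u ^ 2 * real v + 1) / (e * f * real u ^ 2 * real v)"
      using e f u v by (simp add: Z0 add_divide_distrib)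
    moreover have "X 0 = 1 / (e * f * real u * real v)" by (simp add: X0 q_def)
    ultimately have "X 0 / (1 + Z 0) / (e * real u) = 1 / (e * (e * f * real u ^ 2 * real v + 1))"
      using e f u v by (auto simp: power2_eq_square)
    then show ?thesis by (simp add: algebra_simps power2_eq_square)
  qed
  finally have "w 0 = 1 / (e * real u)
      - 1 / (e ^ 2 * f * real u ^ 2 * real v + e) * ((\<Sum>n. num n) / (\<Sum>n. den n))" .
  moreover have "summable num" "summable den"
    unfolding num den by (rule summable_qhyp_term[OF q X Z])+
  ultimately show ?thesis
    using lim limI[OF lim] by (auto simp: convergent_def cfrac_value_def)
qed

end
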